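(* Let $\Gamma$ be an amenable group, and let $V$ be a dual normed $\mathbb{R}[\Gamma]$-module. Then $H^n_b(\Gamma,V)=0$ for every $n\geq 1$.
   Context: All groups are discrete. $\Gamma$ is amenable if there is a linear map $m\colon \ell^\infty(\Gamma)\to\mathbb{R}$ with $m(\mathbf 1_\Gamma)=1$, $m(f)\ge 0$ for $f\ge 0$, and $m(g\cdot f)=m(f)$ for all $g\in\Gamma$, $f\in\ell^\infty(\Gamma)$, where $\ell^\infty(\Gamma)$ is the space of bounded real functions on $\Gamma$ and $(g\cdot f)(h)=f(g^{-1}h)$. A normed $\mathbb{R}[\Gamma]$-module is a real normed space with a linear isometric (left) action of $\Gamma$. It is a dual normed $\mathbb{R}[\Gamma]$-module if it is isomorphic, as a normed $\mathbb{R}[\Gamma]$-module, to the topological dual $W'$ of some normed $\mathbb{R}[\Gamma]$-module $W$, with operator norm and action $(g\cdot f)(w)=f(g^{-1}w)$. For a normed $\mathbb{R}[\Gamma]$-module $V$, $C^n_b(\Gamma,V)$ is the space of functions $f\colon\Gamma^{n+1}\to V$ with $\|f\|_\infty=\sup\|f(g_0,\dots,g_n)\|<\infty$, with action $(g\cdot f)(g_0,\dots,g_n)=g(f(g^{-1}g_0,\dots,g^{-1}g_n))$ and differential $\delta^n f(g_0,\dots,g_{n+1})=\sum_{i=0}^{n+1}(-1)^i f(g_0,\dots,\widehat{g_i},\dots,g_{n+1})$. $H^n_b(\Gamma,V)$ is the $n$-th cohomology of the complex of invariants $C^\bullet_b(\Gamma,V)^\Gamma$. *)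

theory Defs
  imports "HOL-Analysis.Bounded_Linear_Function" "HOL-Algebra.Group_Action"
    "HOL-Algebra.Elementary_Groups"
begin

text \<open>
  Convention: a function on a subset of a type (the carrier of a group, or the tuples over it)
  is represented by the total function that is 0 outside the subset.  Function spaces are
  thereby closed under the pointwise operations, and equality of functions is equality in HOL.
\<close>

section \<open>Amenability\<close>

definition linf :: "('g, 'x) monoid_scheme \<Rightarrow> ('g \<Rightarrow> real) set" where
  "linf G = {f. bounded (f ` carrier G) \<and> (\<forall>h. h \<notin> carrier G \<longrightarrow> f h = 0)}"

definition translate :: "('g, 'x) monoid_scheme \<Rightarrow> 'g \<Rightarrow> ('g \<Rightarrow> real) \<Rightarrow> 'g \<Rightarrow> real" where
  "translate G g f = (\<lambda>h. if h \<in> carrier G then f (inv\<^bsub>G\<^esub> g \<otimes>\<^bsub>G\<^esub> h) else 0)"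

definition invariant_mean :: "('g, 'x) monoid_scheme \<Rightarrow> (('g \<Rightarrow> real) \<Rightarrow> real) \<Rightarrow> bool" where
  "invariant_mean G m \<longleftrightarrow>
     (\<forall>f\<in>linf G. \<forall>h\<in>linf G. m (\<lambda>x. f x + h x) = m f + m h) \<and>
     (\<forall>c. \<forall>f\<in>linf G. m (\<lambda>x. c * f x) = c * m f) \<and>
     m (indicator (carrier G)) = 1 \<and>
     (\<forall>f\<in>linf G. (\<forall>x\<in>carrier G. 0 \<le> f x) \<longrightarrow> 0 \<le> m f) \<and>
     (\<forall>g\<in>carrier G. \<forall>f\<in>linf G. m (translate G g f) = m f)"

definition amenable :: "('g, 'x) monoid_scheme \<Rightarrow> bool" where
  "amenable G \<longleftrightarrow> (\<exists>m. invariant_mean G m)"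


section \<open>Normed modules\<close>

text \<open>The underlying normed space is a type; the action is a function \<open>\<rho>\<close>, whose values at
  arguments outside the carrier of the group play no role.\<close>

definition normed_module ::
    "('g, 'x) monoid_scheme \<Rightarrow> ('g \<Rightarrow> 'v::real_normed_vector \<Rightarrow> 'v) \<Rightarrow> bool" where
  "normed_module G \<rho> \<longleftrightarrow>
     group_action G UNIV \<rho> \<and>
     (\<forall>g\<in>carrier G. linear (\<rho> g) \<and> (\<forall>v. norm (\<rho> g v) = norm v))"

text \<open>The morphisms of normed modules are the bounded linear equivariant maps, so an isomorphism
  is not required to be isometric (in particular, isometric isomorphisms are covered).\<close>

definition normed_module_iso ::
    "('g, 'x) monoid_scheme \<Rightarrow> ('g \<Rightarrow> 'v::real_normed_vector \<Rightarrow> 'v) \<Rightarrow>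
     ('g \<Rightarrow> 'u::real_normed_vector \<Rightarrow> 'u) \<Rightarrow> bool" where
  "normed_module_iso G \<rho> \<tau> \<longleftrightarrow>
     (\<exists>T S. bounded_linear T \<and> bounded_linear S \<and>
        (\<forall>v. S (T v) = v) \<and> (\<forall>u. T (S u) = u) \<and>
        (\<forall>g\<in>carrier G. \<forall>v. T (\<rho> g v) = \<tau> g (T v)))"

text \<open>The topological dual of \<open>'w\<close> is the type \<open>'w \<Rightarrow>\<^sub>L real\<close>, normed by the operator norm.\<close>

definition dual_action ::
    "('g, 'x) monoid_scheme \<Rightarrow> ('g \<Rightarrow> 'w::real_normed_vector \<Rightarrow> 'w) \<Rightarrow>
     'g \<Rightarrow> ('w \<Rightarrow>\<^sub>L real) \<Rightarrow> ('w \<Rightarrow>\<^sub>L real)" where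
  "dual_action G \<sigma> g f = Blinfun (\<lambda>w. blinfun_apply f (\<sigma> (inv\<^bsub>G\<^esub> g) w))"

text \<open>HOL cannot quantify existentially over types, so the type of the predual is a parameter.
  Left as a type variable in the hypothesis of a theorem, it is universally quantified there,
  which amounts to the existential hypothesis that some predual exists.\<close>

definition dual_normed_module ::
    "'w::real_normed_vector itself \<Rightarrow> ('g, 'x) monoid_scheme \<Rightarrow>
     ('g \<Rightarrow> 'v::real_normed_vector \<Rightarrow> 'v) \<Rightarrow> bool" where
  "dual_normed_module W G \<rho> \<longleftrightarrow>
     normed_module G \<rho> \<and>
     (\<exists>\<sigma> :: 'g \<Rightarrow> 'w \<Rightarrow> 'w. normed_module G \<sigma> \<and> normed_module_iso G \<rho> (dual_action G \<sigma>))"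


section \<open>Bounded cohomology\<close>

text \<open>Tuples are lists: \<open>(g\<^sub>0, \<dots>, g\<^sub>n)\<close> is an element of \<open>tuples G (Suc n)\<close>.\<close>

definition tuples :: "('g, 'x) monoid_scheme \<Rightarrow> nat \<Rightarrow> 'g list set" where
  "tuples G k = {xs. length xs = k \<and> set xs \<subseteq> carrier G}"

definition bounded_cochains ::
    "('g, 'x) monoid_scheme \<Rightarrow> nat \<Rightarrow> ('g list \<Rightarrow> 'v::real_normed_vector) set" where
  "bounded_cochains G n =
     {f. bounded (f ` tuples G (Suc n)) \<and> (\<forall>xs. xs \<notin> tuples G (Suc n) \<longrightarrow> f xs = 0)}"

definition cochain_action ::
    "('g, 'x) monoid_scheme \<Rightarrow> ('g \<Rightarrow> 'v::real_normed_vector \<Rightarrow> 'v) \<Rightarrow> nat \<Rightarrow>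
     'g \<Rightarrow> ('g list \<Rightarrow> 'v) \<Rightarrow> 'g list \<Rightarrow> 'v" where
  "cochain_action G \<rho> n g f =
     (\<lambda>xs. if xs \<in> tuples G (Suc n)
            then \<rho> g (f (map (\<lambda>x. inv\<^bsub>G\<^esub> g \<otimes>\<^bsub>G\<^esub> x) xs)) else 0)"

definition invariant_cochains ::
    "('g, 'x) monoid_scheme \<Rightarrow> ('g \<Rightarrow> 'v::real_normed_vector \<Rightarrow> 'v) \<Rightarrow> nat \<Rightarrow>
     ('g list \<Rightarrow> 'v) set" where
  "invariant_cochains G \<rho> n =
     {f \<in> bounded_cochains G n. \<forall>g\<in>carrier G. cochain_action G \<rho> n g f = f}"

definition omit :: "nat \<Rightarrow> 'a list \<Rightarrow> 'a list" where
  "omit i xs = take i xs @ drop (Suc i) xs"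

definition differential ::
    "('g, 'x) monoid_scheme \<Rightarrow> nat \<Rightarrow> ('g list \<Rightarrow> 'v::real_normed_vector) \<Rightarrow> 'g list \<Rightarrow> 'v" where
  "differential G n f =
     (\<lambda>xs. if xs \<in> tuples G (Suc (Suc n))
            then (\<Sum>i = 0..n + 1. (-1) ^ i *\<^sub>R f (omit i xs)) else 0)"

definition cocycles ::
    "('g, 'x) monoid_scheme \<Rightarrow> ('g \<Rightarrow> 'v::real_normed_vector \<Rightarrow> 'v) \<Rightarrow> nat \<Rightarrow>
     ('g list \<Rightarrow> 'v) set" where
  "cocycles G \<rho> n = {f \<in> invariant_cochains G \<rho> n. differential G n f = (\<lambda>xs. 0)}"

primrec coboundaries ::
    "('g, 'x) monoid_scheme \<Rightarrow> ('g \<Rightarrow> 'v::real_normed_vector \<Rightarrow> 'v) \<Rightarrow> nat \<Rightarrow>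
     ('g list \<Rightarrow> 'v) set" where
  "coboundaries G \<rho> 0 = {\<lambda>xs. 0}"
| "coboundaries G \<rho> (Suc n) = differential G n ` invariant_cochains G \<rho> n"

definition cocycle_group ::
    "('g, 'x) monoid_scheme \<Rightarrow> ('g \<Rightarrow> 'v::real_normed_vector \<Rightarrow> 'v) \<Rightarrow> nat \<Rightarrow>
     ('g list \<Rightarrow> 'v) monoid" where
  "cocycle_group G \<rho> n =
     \<lparr>carrier = cocycles G \<rho> n, mult = (\<lambda>f h xs. f xs + h xs), one = (\<lambda>xs. 0)\<rparr>"

text \<open>Only the underlying additive group of the quotient vector space is recorded; the vector
  space is zero iff this group is trivial.\<close>

definition bounded_cohomology ::
    "('g, 'x) monoid_scheme \<Rightarrow> ('g \<Rightarrow> 'v::real_normed_vector \<Rightarrow> 'v) \<Rightarrow> nat \<Rightarrow>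
     ('g list \<Rightarrow> 'v) set monoid" where
  "bounded_cohomology G \<rho> n = cocycle_group G \<rho> n Mod coboundaries G \<rho> n"

end

theory Submission
  imports Defs
begin

text \<open>
  The idea: an invariant mean on \<open>G\<close> averages not only bounded real functions but also bounded
  functions \<open>F\<close> from \<open>G\<close> to a dual module \<open>W'\<close>.  The average is defined weakly, as the functional
  sending \<open>w\<close> to the mean of the scalar function \<open>x \<mapsto> F x w\<close>; this is where duality is needed,
  since in a general module no vector with these values need exist.  Invariance of the scalar
  mean turns into equivariance of the vector-valued one, and an isomorphism of modules carries
  it from \<open>W'\<close> to \<open>V\<close> (lemmas \<open>module_mean_dual\<close> and \<open>module_mean_transport\<close>).

  Without the invariance condition, inserting a fixed element \<open>x\<close> in front of a tuple is a
  contraction of the complex of bounded cochains: if \<open>f\<close> is a cocycle, then evaluating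
  \<open>\<delta> f = 0\<close> at \<open>(x, g\<^sub>0, \<dots>, g\<^sub>n)\<close> writes \<open>f\<close> as the differential of \<open>f (x, \<dots>)\<close>.
  This primitive depends on the choice of \<open>x\<close>, hence is not invariant in general.  Averaging it over all \<open>x\<close>
  with the equivariant mean makes it invariant and keeps it bounded.  It is still a primitive
  of \<open>f\<close>, because the mean is linear and fixes \<open>f (g\<^sub>0, \<dots>, g\<^sub>n)\<close>, which is constant in \<open>x\<close>
  (lemmas \<open>average_invariant\<close> and \<open>differential_average\<close>).  Hence every cocycle of positive
  degree is the coboundary of an invariant bounded cochain.
\<close>

section \<open>Means on bounded functions\<close>

text \<open>The vector-valued analogue of an invariant mean.  The factor \<open>C\<close> in the bound is there so
  that the notion is stable under isomorphisms of modules that are not isometric.\<close>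

locale module_mean = group G for G :: "('g, 'x) monoid_scheme" (structure) +
  fixes \<rho> :: "'g \<Rightarrow> 'v::real_normed_vector \<Rightarrow> 'v" and M :: "('g \<Rightarrow> 'v) \<Rightarrow> 'v"
  assumes mean_add: "bounded (F ` carrier G) \<Longrightarrow> bounded (F' ` carrier G) \<Longrightarrow>
      M (\<lambda>x. F x + F' x) = M F + M F'"
    and mean_scaleR: "bounded (F ` carrier G) \<Longrightarrow> M (\<lambda>x. c *\<^sub>R F x) = c *\<^sub>R M F"
    and mean_const: "M (\<lambda>x. v) = v"
    and mean_bound: "\<exists>C. \<forall>F b. (\<forall>x\<in>carrier G. norm (F x) \<le> b) \<longrightarrow> norm (M F) \<le> C * b"
    and mean_equivariant: "g \<in> carrier G \<Longrightarrow> bounded (F ` carrier G) \<Longrightarrow>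
      M (\<lambda>x. \<rho> g (F (inv g \<otimes> x))) = \<rho> g (M F)"

lemma bounded_image_iff: "bounded (F ` A) \<longleftrightarrow> (\<exists>b. \<forall>x\<in>A. norm (F x) \<le> b)"
  by (simp add: bounded_iff)

lemma bounded_image_sum:
  fixes F :: "'i \<Rightarrow> 'a \<Rightarrow> 'b::real_normed_vector"
  assumes "finite I" "\<And>i. i \<in> I \<Longrightarrow> bounded (F i ` A)"
  shows "bounded ((\<lambda>x. \<Sum>i\<in>I. F i x) ` A)"
  using assms
  by (induction I rule: finite_induct) (simp_all add: image_constant_conv bounded_plus_comp)

lemma bounded_image_linear:
  assumes "bounded_linear T" "bounded (F ` A)"
  shows "bounded ((\<lambda>x. T (F x)) ` A)"
  using bounded_linear_image[OF assms(2,1)] by (simp add: image_image)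

context module_mean
begin

text \<open>On the difference of two functions that agree on the group, the bound holds with \<open>b = 0\<close>.\<close>

lemma mean_cong:
  assumes "bounded (F ` carrier G)" "\<And>x. x \<in> carrier G \<Longrightarrow> F x = F' x"
  shows "M F = M F'"
proof -
  have bd': "bounded (F' ` carrier G)"
    using assms by (metis (mono_tags, lifting) image_cong)
  have bd0: "bounded ((\<lambda>x. F x - F' x) ` carrier G)"
    using assms(2) by (auto simp: bounded_image_iff intro!: exI[of _ 0])
  obtain C where C: "\<And>F b. \<forall>x\<in>carrier G. norm (F x) \<le> b \<Longrightarrow> norm (M F) \<le> C * b"
    using mean_bound by blast
  have "norm (M (\<lambda>x. F x - F' x)) \<le> C * 0"
    by (rule C) (use assms(2) in auto)
  then have "M (\<lambda>x. F x - F' x) = 0"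
    by simp
  then show ?thesis
    using mean_add[OF bd0 bd'] by simp
qed

lemma mean_sum:
  assumes "finite I" "\<And>i. i \<in> I \<Longrightarrow> bounded (F i ` carrier G)"
  shows "M (\<lambda>x. \<Sum>i\<in>I. F i x) = (\<Sum>i\<in>I. M (F i))"
  using assms
proof (induction I rule: finite_induct)
  case empty
  show ?case by (simp add: mean_const)
next
  case (insert j I)
  then show ?case
    using mean_add[of "F j" "\<lambda>x. \<Sum>i\<in>I. F i x"] bounded_image_sum[of I F "carrier G"] by simp
qed

end


section \<open>Dual modules over an amenable group have an equivariant mean\<close>

definition zero_off :: "('g, 'x) monoid_scheme \<Rightarrow> ('g \<Rightarrow> real) \<Rightarrow> 'g \<Rightarrow> real" where
  "zero_off G f = (\<lambda>x. if x \<in> carrier G then f x else 0)"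

lemma zero_off_linf: "bounded (f ` carrier G) \<Longrightarrow> zero_off G f \<in> linf G"
  by (simp add: linf_def zero_off_def cong: image_cong_simp)

lemma invariant_mean_add:
  assumes "invariant_mean G m" "bounded (f ` carrier G)" "bounded (h ` carrier G)"
  shows "m (zero_off G (\<lambda>x. f x + h x)) = m (zero_off G f) + m (zero_off G h)"
proof -
  have "m (\<lambda>x. zero_off G f x + zero_off G h x) = m (zero_off G f) + m (zero_off G h)"
    using assms(1) assms(2-)[THEN zero_off_linf] unfolding invariant_mean_def by blast
  moreover have "(\<lambda>x. zero_off G f x + zero_off G h x) = zero_off G (\<lambda>x. f x + h x)"
    by (auto simp: zero_off_def)
  ultimately show ?thesis by simp
qed

lemma invariant_mean_mult:
  assumes "invariant_mean G m" "bounded (f ` carrier G)"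
  shows "m (zero_off G (\<lambda>x. c * f x)) = c * m (zero_off G f)"
proof -
  have "m (\<lambda>x. c * zero_off G f x) = c * m (zero_off G f)"
    using assms(1) assms(2-)[THEN zero_off_linf] unfolding invariant_mean_def by blast
  moreover have "(\<lambda>x. c * zero_off G f x) = zero_off G (\<lambda>x. c * f x)"
    by (auto simp: zero_off_def)
  ultimately show ?thesis by simp
qed

lemma invariant_mean_const:
  assumes "invariant_mean G m"
  shows "m (zero_off G (\<lambda>x. c)) = c"
proof -
  have "zero_off G (\<lambda>x. 1) = indicator (carrier G)"
    by (auto simp: zero_off_def indicator_def)
  then have "m (zero_off G (\<lambda>x. 1)) = 1"
    using assms unfolding invariant_mean_def by simp
  moreover have "bounded ((\<lambda>x. 1 :: real) ` carrier G)"
    by (auto simp: bounded_image_iff)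
  ultimately show ?thesis
    using invariant_mean_mult[OF assms, of "\<lambda>x. 1" c] by simp
qed

lemma invariant_mean_nonneg:
  assumes "invariant_mean G m" "bounded (f ` carrier G)" "\<And>x. x \<in> carrier G \<Longrightarrow> 0 \<le> f x"
  shows "0 \<le> m (zero_off G f)"
proof -
  have "\<forall>x\<in>carrier G. 0 \<le> zero_off G f x"
    using assms(3) by (simp add: zero_off_def)
  then show ?thesis
    using assms(1) zero_off_linf[OF assms(2)] unfolding invariant_mean_def by blast
qed

text \<open>Positivity applied to \<open>b - f\<close> and \<open>b + f\<close>.\<close>

lemma invariant_mean_abs_le:
  assumes m: "invariant_mean G m" and le: "\<And>x. x \<in> carrier G \<Longrightarrow> \<bar>f x\<bar> \<le> b"
  shows "\<bar>m (zero_off G f)\<bar> \<le> b"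
proof -
  have bd: "bounded ((\<lambda>x. s * f x) ` carrier G)" "bounded ((\<lambda>x. b) ` carrier G)"
    if "\<bar>s\<bar> = 1" for s
    using le that by (auto simp: bounded_image_iff abs_mult)
  have "s * m (zero_off G f) \<le> b" if s: "\<bar>s\<bar> = 1" for s
  proof -
    have bdf: "bounded (f ` carrier G)"
      using le by (auto simp: bounded_image_iff)
    have "0 \<le> m (zero_off G (\<lambda>x. b + - s * f x))"
    proof (rule invariant_mean_nonneg[OF m])
      show "bounded ((\<lambda>x. b + - s * f x) ` carrier G)"
        by (rule bounded_plus_comp) (use bd s in auto)
      show "0 \<le> b + - s * f x" if "x \<in> carrier G" for x
        using le[OF that] s by (cases "0 \<le> s") auto
    qed
    also have "\<dots> = b + - s * m (zero_off G f)"
      using invariant_mean_add[OF m, of "\<lambda>x. b" "\<lambda>x. - s * f x"] bd[of "- s"] s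
        invariant_mean_mult[OF m bdf, of "- s"] invariant_mean_const[OF m, of b] by simp
    finally show ?thesis by simp
  qed
  from this[of 1] this[of "- 1"] show ?thesis by auto
qed

lemma invariant_mean_translate:
  assumes "group G" "invariant_mean G m" "bounded (f ` carrier G)" "g \<in> carrier G"
  shows "m (zero_off G (\<lambda>x. f (inv\<^bsub>G\<^esub> g \<otimes>\<^bsub>G\<^esub> x))) = m (zero_off G f)"
proof -
  interpret group G by fact
  have "translate G g (zero_off G f) = zero_off G (\<lambda>x. f (inv\<^bsub>G\<^esub> g \<otimes>\<^bsub>G\<^esub> x))"
    using assms(4) by (auto simp: translate_def zero_off_def)
  then show ?thesis
    using assms zero_off_linf unfolding invariant_mean_def by metis
qed

text \<open>The average, in the weak-* sense, of a function with values in a dual space.\<close>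

definition weak_mean ::
    "('g, 'x) monoid_scheme \<Rightarrow> (('g \<Rightarrow> real) \<Rightarrow> real) \<Rightarrow>
     ('g \<Rightarrow> 'w::real_normed_vector \<Rightarrow>\<^sub>L real) \<Rightarrow> 'w \<Rightarrow>\<^sub>L real" where
  "weak_mean G m F = Blinfun (\<lambda>w. m (zero_off G (\<lambda>x. blinfun_apply (F x) w)))"

lemma bounded_image_blinfun_apply:
  assumes "bounded (F ` A)"
  shows "bounded ((\<lambda>x. blinfun_apply (F x) w) ` A)"
  using bounded_image_linear[OF blinfun.bounded_linear_left assms] .

lemma bounded_linear_mean_apply:
  assumes m: "invariant_mean G m" and le: "\<And>x. x \<in> carrier G \<Longrightarrow> norm (F x) \<le> b"
  shows "bounded_linear (\<lambda>w. m (zero_off G (\<lambda>x. blinfun_apply (F x) w)))"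
proof (rule bounded_linear_intro[where K = b])
  have bd: "bounded ((\<lambda>x. blinfun_apply (F x) w) ` carrier G)" for w
    by (rule bounded_image_blinfun_apply) (use le in \<open>auto simp: bounded_image_iff\<close>)
  show "m (zero_off G (\<lambda>x. blinfun_apply (F x) (v + w))) =
      m (zero_off G (\<lambda>x. blinfun_apply (F x) v)) + m (zero_off G (\<lambda>x. blinfun_apply (F x) w))"
    for v w
    unfolding blinfun.add_right by (rule invariant_mean_add[OF m bd bd])
  show "m (zero_off G (\<lambda>x. blinfun_apply (F x) (c *\<^sub>R w))) =
      c *\<^sub>R m (zero_off G (\<lambda>x. blinfun_apply (F x) w))" for c w
    unfolding blinfun.scaleR_right real_scaleR_def by (rule invariant_mean_mult[OF m bd])
  show "norm (m (zero_off G (\<lambda>x. blinfun_apply (F x) w))) \<le> norm w * b" for w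
    unfolding real_norm_def
  proof (rule invariant_mean_abs_le[OF m])
    fix x assume "x \<in> carrier G"
    then have "norm (F x) * norm w \<le> b * norm w"
      by (intro mult_right_mono le) auto
    then show "\<bar>blinfun_apply (F x) w\<bar> \<le> norm w * b"
      using norm_blinfun[of "F x" w] by (simp add: mult.commute)
  qed
qed

lemma weak_mean_apply:
  assumes "invariant_mean G m" "bounded (F ` carrier G)"
  shows "blinfun_apply (weak_mean G m F) w = m (zero_off G (\<lambda>x. blinfun_apply (F x) w))"
proof -
  obtain b where "\<And>x. x \<in> carrier G \<Longrightarrow> norm (F x) \<le> b"
    using assms(2) unfolding bounded_image_iff by blast
  from bounded_linear_mean_apply[OF assms(1) this] show ?thesis
    by (simp add: weak_mean_def bounded_linear_Blinfun_apply)
qed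

lemma bounded_linear_module_action:
  assumes "normed_module G \<sigma>" "g \<in> carrier G"
  shows "bounded_linear (\<sigma> g)"
  using assms unfolding normed_module_def
  by (auto intro!: bounded_linear_intro[where K = 1] simp: linear_add linear_scale)

lemma dual_action_apply:
  assumes "group G" "normed_module G \<sigma>" "g \<in> carrier G"
  shows "blinfun_apply (dual_action G \<sigma> g f) w = blinfun_apply f (\<sigma> (inv\<^bsub>G\<^esub> g) w)"
  unfolding dual_action_def
  by (subst bounded_linear_Blinfun_apply)
    (auto intro!: bounded_linear_blinfun_apply bounded_linear_module_action assms
      group.inv_closed)

lemma norm_dual_action_le:
  assumes "group G" "normed_module G \<sigma>" "g \<in> carrier G"
  shows "norm (dual_action G \<sigma> g f) \<le> norm f"
proof (rule norm_blinfun_bound)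
  fix w
  have "norm (\<sigma> (inv\<^bsub>G\<^esub> g) w) = norm w"
    using assms group.inv_closed unfolding normed_module_def by metis
  then show "norm (blinfun_apply (dual_action G \<sigma> g f) w) \<le> norm f * norm w"
    using norm_blinfun[of f "\<sigma> (inv\<^bsub>G\<^esub> g) w"] by (simp add: dual_action_apply[OF assms])
qed simp

text \<open>Every property of the vector-valued mean is checked on a single vector of the predual, where
  it is the corresponding property of the scalar mean.\<close>

lemma module_mean_dual:
  assumes G: "group G" and m: "invariant_mean G m" and \<sigma>: "normed_module G \<sigma>"
  shows "module_mean G (dual_action G \<sigma>) (weak_mean G m)"
proof -
  interpret group G by (fact G)
  note app = weak_mean_apply[OF m] and bda = bounded_image_blinfun_apply
  show ?thesis
  proof
    fix F F' :: "'a \<Rightarrow> 'c \<Rightarrow>\<^sub>L real"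
    assume "bounded (F ` carrier G)" "bounded (F' ` carrier G)"
    then show "weak_mean G m (\<lambda>x. F x + F' x) = weak_mean G m F + weak_mean G m F'"
      by (intro blinfun_eqI)
        (simp add: app bounded_plus_comp blinfun.add_left invariant_mean_add[OF m] bda)
  next
    fix F :: "'a \<Rightarrow> 'c \<Rightarrow>\<^sub>L real" and c
    assume "bounded (F ` carrier G)"
    then show "weak_mean G m (\<lambda>x. c *\<^sub>R F x) = c *\<^sub>R weak_mean G m F"
      by (intro blinfun_eqI)
        (simp add: app bounded_scaleR_comp blinfun.scaleR_left invariant_mean_mult[OF m] bda)
  next
    fix v :: "'c \<Rightarrow>\<^sub>L real"
    have "bounded ((\<lambda>x. v) ` carrier G)"
      by (auto simp: bounded_image_iff)
    then show "weak_mean G m (\<lambda>x. v) = v"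
      by (intro blinfun_eqI) (simp add: app invariant_mean_const[OF m])
  next
    have "norm (weak_mean G m F) \<le> 1 * b"
      if le: "\<forall>x\<in>carrier G. norm (F x) \<le> b" for F :: "'a \<Rightarrow> 'c \<Rightarrow>\<^sub>L real" and b
      unfolding mult_1
    proof (rule norm_blinfun_bound)
      show "0 \<le> b"
        using le one_closed norm_ge_zero order_trans by blast
      have bd: "bounded (F ` carrier G)"
        using le by (auto simp: bounded_image_iff)
      show "norm (blinfun_apply (weak_mean G m F) w) \<le> b * norm w" for w
        unfolding app[OF bd] real_norm_def
      proof (rule invariant_mean_abs_le[OF m])
        fix x assume "x \<in> carrier G"
        then have "norm (F x) * norm w \<le> b * norm w"
          by (intro mult_right_mono) (use le in auto)
        then show "\<bar>blinfun_apply (F x) w\<bar> \<le> b * norm w"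
          using norm_blinfun[of "F x" w] by simp
      qed
    qed
    then show "\<exists>C. \<forall>F b. (\<forall>x\<in>carrier G. norm (F x) \<le> b) \<longrightarrow>
        norm (weak_mean G m F :: 'c \<Rightarrow>\<^sub>L real) \<le> C * b"
      by blast
  next
    fix g and F :: "'a \<Rightarrow> 'c \<Rightarrow>\<^sub>L real"
    assume g: "g \<in> carrier G" and bd: "bounded (F ` carrier G)"
    let ?F = "\<lambda>x. dual_action G \<sigma> g (F (inv\<^bsub>G\<^esub> g \<otimes>\<^bsub>G\<^esub> x))"
    obtain b where "\<And>x. x \<in> carrier G \<Longrightarrow> norm (F x) \<le> b"
      using bd unfolding bounded_image_iff by blast
    then have bd': "bounded (?F ` carrier G)"
      unfolding bounded_image_iff
      using norm_dual_action_le[OF G \<sigma> g] g by (meson inv_closed m_closed order_trans)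
    show "weak_mean G m ?F = dual_action G \<sigma> g (weak_mean G m F)"
      by (rule blinfun_eqI)
        (simp add: app[OF bd'] app[OF bd] dual_action_apply[OF G \<sigma> g]
          invariant_mean_translate[OF G m bda[OF bd] g])
  qed
qed

lemma module_mean_transport:
  assumes "module_mean G \<tau> M" "normed_module_iso G \<rho> \<tau>"
  shows "\<exists>M'. module_mean G \<rho> M'"
proof -
  interpret module_mean G \<tau> M by fact
  obtain T S where T: "bounded_linear T" and S: "bounded_linear S"
    and ST: "\<And>v. S (T v) = v" and TS: "\<And>u. T (S u) = u"
    and eq: "\<And>g v. g \<in> carrier G \<Longrightarrow> T (\<rho> g v) = \<tau> g (T v)"
    using assms(2) unfolding normed_module_iso_def by blast
  interpret T: bounded_linear T by fact
  interpret S: bounded_linear S by fact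
  have "module_mean G \<rho> (\<lambda>F. S (M (\<lambda>x. T (F x))))"
  proof
    fix F F' :: "'a \<Rightarrow> 'd"
    assume "bounded (F ` carrier G)" "bounded (F' ` carrier G)"
    then show "S (M (\<lambda>x. T (F x + F' x))) = S (M (\<lambda>x. T (F x))) + S (M (\<lambda>x. T (F' x)))"
      by (simp add: T.add S.add mean_add bounded_image_linear[OF T])
  next
    fix F :: "'a \<Rightarrow> 'd" and c
    assume "bounded (F ` carrier G)"
    then show "S (M (\<lambda>x. T (c *\<^sub>R F x))) = c *\<^sub>R S (M (\<lambda>x. T (F x)))"
      by (simp add: T.scaleR S.scaleR mean_scaleR bounded_image_linear[OF T])
  next
    show "S (M (\<lambda>x. T v)) = v" for v
      by (simp add: mean_const ST)
  next
    obtain C where C: "\<And>F b. \<forall>x\<in>carrier G. norm (F x) \<le> b \<Longrightarrow> norm (M F) \<le> C * b"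
      using mean_bound by blast
    obtain Kt where Kt: "\<And>v. norm (T v) \<le> norm v * Kt" and Kt0: "0 \<le> Kt"
      using T.nonneg_bounded by blast
    obtain Ks where Ks: "\<And>u. norm (S u) \<le> norm u * Ks" and Ks0: "0 \<le> Ks"
      using S.nonneg_bounded by blast
    have "norm (S (M (\<lambda>x. T (F x)))) \<le> (C * Kt * Ks) * b"
      if le: "\<forall>x\<in>carrier G. norm (F x) \<le> b" for F b
    proof -
      have "norm (M (\<lambda>x. T (F x))) \<le> C * (b * Kt)"
        by (intro C ballI order_trans[OF Kt] mult_right_mono) (use le Kt0 in auto)
      from order_trans[OF Ks mult_right_mono[OF this Ks0]] show ?thesis
        by (simp add: ac_simps)
    qed
    then show "\<exists>C. \<forall>F b. (\<forall>x\<in>carrier G. norm (F x) \<le> b) \<longrightarrow>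
        norm (S (M (\<lambda>x. T (F x)))) \<le> C * b"
      by blast
  next
    fix g and F :: "'a \<Rightarrow> 'd"
    assume g: "g \<in> carrier G" and bd: "bounded (F ` carrier G)"
    have "T (\<rho> g (S (M (\<lambda>x. T (F x))))) = M (\<lambda>x. T (\<rho> g (F (inv\<^bsub>G\<^esub> g \<otimes>\<^bsub>G\<^esub> x))))"
      using mean_equivariant[OF g bounded_image_linear[OF T bd]] by (simp add: eq[OF g] TS)
    then show "S (M (\<lambda>x. T (\<rho> g (F (inv\<^bsub>G\<^esub> g \<otimes>\<^bsub>G\<^esub> x))))) = \<rho> g (S (M (\<lambda>x. T (F x))))"
      by (metis ST)
  qed
  then show ?thesis by blast
qed


section \<open>The averaged contraction\<close>

lemma invariant_cochainD:
  assumes "f \<in> invariant_cochains G \<rho> n" "g \<in> carrier G" "xs \<in> tuples G (Suc n)"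
  shows "\<rho> g (f (map (\<lambda>x. inv\<^bsub>G\<^esub> g \<otimes>\<^bsub>G\<^esub> x) xs)) = f xs"
proof -
  have "cochain_action G \<rho> n g f xs = f xs"
    using assms unfolding invariant_cochains_def by simp
  then show ?thesis
    using assms(3) by (simp add: cochain_action_def)
qed

lemma omit_tuples:
  assumes "xs \<in> tuples G (Suc n)" "i \<le> n"
  shows "omit i xs \<in> tuples G n"
  using assms by (auto simp: tuples_def omit_def dest: in_set_takeD in_set_dropD)

context module_mean
begin

definition average :: "nat \<Rightarrow> ('g list \<Rightarrow> 'v) \<Rightarrow> 'g list \<Rightarrow> 'v" where
  "average k f = (\<lambda>xs. if xs \<in> tuples G (Suc k) then M (\<lambda>x. f (x # xs)) else 0)"

lemma bounded_slice:
  assumes "f \<in> bounded_cochains G (Suc k)" "xs \<in> tuples G (Suc k)"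
  shows "bounded ((\<lambda>x. f (x # xs)) ` carrier G)"
proof (rule bounded_subset)
  show "bounded (f ` tuples G (Suc (Suc k)))"
    using assms(1) by (simp add: bounded_cochains_def)
  show "(\<lambda>x. f (x # xs)) ` carrier G \<subseteq> f ` tuples G (Suc (Suc k))"
    using assms(2) by (auto simp: tuples_def)
qed

lemma average_bounded:
  assumes "f \<in> bounded_cochains G (Suc k)"
  shows "average k f \<in> bounded_cochains G k"
proof -
  obtain b where b: "\<And>ys. ys \<in> tuples G (Suc (Suc k)) \<Longrightarrow> norm (f ys) \<le> b"
    using assms unfolding bounded_cochains_def bounded_image_iff by blast
  obtain C where C: "\<And>F b. \<forall>x\<in>carrier G. norm (F x) \<le> b \<Longrightarrow> norm (M F) \<le> C * b"
    using mean_bound by blast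
  have "norm (average k f xs) \<le> C * b" if "xs \<in> tuples G (Suc k)" for xs
    using that by (auto simp: average_def tuples_def intro!: C b)
  then show ?thesis
    unfolding bounded_cochains_def bounded_image_iff by (auto simp: average_def)
qed

text \<open>Translating the tuple by \<open>g\<close> amounts, by invariance of \<open>f\<close>, to translating the averaged
  variable, and this the mean absorbs.\<close>

lemma average_invariant:
  assumes f: "f \<in> invariant_cochains G \<rho> (Suc k)"
  shows "average k f \<in> invariant_cochains G \<rho> k"
proof -
  have fb: "f \<in> bounded_cochains G (Suc k)"
    using f by (simp add: invariant_cochains_def)
  have "cochain_action G \<rho> k g (average k f) = average k f" if g: "g \<in> carrier G" for g
  proof
    fix xs
    let ?t = "\<lambda>x. inv g \<otimes> x"
    show "cochain_action G \<rho> k g (average k f) xs = average k f xs"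
    proof (cases "xs \<in> tuples G (Suc k)")
      case True
      then have txs: "map ?t xs \<in> tuples G (Suc k)"
        using g by (auto simp: tuples_def)
      have "cochain_action G \<rho> k g (average k f) xs = \<rho> g (M (\<lambda>x. f (x # map ?t xs)))"
        using True txs by (simp add: cochain_action_def average_def)
      also have "\<dots> = M (\<lambda>x. \<rho> g (f (?t x # map ?t xs)))"
        using mean_equivariant[OF g bounded_slice[OF fb txs]] by simp
      also have "\<dots> = M (\<lambda>x. f (x # xs))"
      proof (rule mean_cong[symmetric, OF bounded_slice[OF fb True]])
        fix x assume "x \<in> carrier G"
        then have "x # xs \<in> tuples G (Suc (Suc k))"
          using True by (auto simp: tuples_def)
        from invariant_cochainD[OF f g this]
        show "f (x # xs) = \<rho> g (f (?t x # map ?t xs))" by simp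
      qed
      finally show ?thesis
        using True by (simp add: average_def)
    qed (simp add: cochain_action_def average_def)
  qed
  then show ?thesis
    using average_bounded[OF fb] by (simp add: invariant_cochains_def)
qed

text \<open>In \<open>\<delta> f (x, g\<^sub>0, \<dots>) = 0\<close>, the face omitting \<open>x\<close> contributes \<open>f (g\<^sub>0, \<dots>)\<close> and the others form,
  up to sign, the differential of \<open>f (x, \<dots>)\<close>; the mean over \<open>x\<close> commutes with this finite sum.\<close>

lemma differential_average:
  assumes f: "f \<in> bounded_cochains G (Suc k)"
    and cocycle: "differential G (Suc k) f = (\<lambda>xs. 0)"
  shows "differential G k (average k f) = f"
proof
  fix xs
  show "differential G k (average k f) xs = f xs"
  proof (cases "xs \<in> tuples G (Suc (Suc k))")
    case True
    let ?I = "{0..k + 1}"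
    have om: "omit i xs \<in> tuples G (Suc k)" if "i \<in> ?I" for i
      using omit_tuples[OF True, of i] that by simp
    have bd: "bounded ((\<lambda>x. f (x # omit i xs)) ` carrier G)" if "i \<in> ?I" for i
      by (rule bounded_slice[OF f om[OF that]])
    have eq: "(\<Sum>i\<in>?I. (- 1) ^ i *\<^sub>R f (x # omit i xs)) = f xs" if x: "x \<in> carrier G" for x
    proof -
      have "x # xs \<in> tuples G (Suc (Suc (Suc k)))"
        using True x by (auto simp: tuples_def)
      then have "0 = (\<Sum>i = 0..Suc (k + 1). (- 1) ^ i *\<^sub>R f (omit i (x # xs)))"
        using fun_cong[OF cocycle, of "x # xs"] by (simp add: differential_def)
      also have "\<dots> = f xs + (\<Sum>i\<in>?I. (- 1) ^ Suc i *\<^sub>R f (omit (Suc i) (x # xs)))"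
        unfolding sum.atLeast0_atMost_Suc_shift by (simp add: omit_def)
      also have "\<dots> = f xs - (\<Sum>i\<in>?I. (- 1) ^ i *\<^sub>R f (x # omit i xs))"
        by (simp add: omit_def sum_negf)
      finally show ?thesis by simp
    qed
    have "differential G k (average k f) xs
        = (\<Sum>i\<in>?I. (- 1) ^ i *\<^sub>R M (\<lambda>x. f (x # omit i xs)))"
      using True om by (simp add: differential_def average_def)
    also have "\<dots> = (\<Sum>i\<in>?I. M (\<lambda>x. (- 1) ^ i *\<^sub>R f (x # omit i xs)))"
      by (intro sum.cong refl mean_scaleR[symmetric] bd)
    also have "\<dots> = M (\<lambda>x. \<Sum>i\<in>?I. (- 1) ^ i *\<^sub>R f (x # omit i xs))"
      by (intro mean_sum[symmetric] finite_atLeastAtMost bounded_scaleR_comp bd)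
    also have "\<dots> = M (\<lambda>x. f xs)"
      by (intro mean_cong bounded_image_sum finite_atLeastAtMost bounded_scaleR_comp bd eq)
    finally show ?thesis
      by (simp add: mean_const)
  next
    case False
    then show ?thesis
      using f by (simp add: differential_def bounded_cochains_def)
  qed
qed

lemma cocycles_subset_coboundaries: "cocycles G \<rho> (Suc k) \<subseteq> coboundaries G \<rho> (Suc k)"
proof
  fix f assume "f \<in> cocycles G \<rho> (Suc k)"
  then have "f \<in> invariant_cochains G \<rho> (Suc k)" "differential G (Suc k) f = (\<lambda>xs. 0)"
    by (auto simp: cocycles_def)
  then have "f = differential G k (average k f)" "average k f \<in> invariant_cochains G \<rho> k"
    using differential_average average_invariant by (auto simp: invariant_cochains_def)
  then show "f \<in> coboundaries G \<rho> (Suc k)"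
    by auto
qed

end


section \<open>Vanishing of the quotient\<close>

text \<open>The coset of an element of \<open>H\<close> is \<open>H\<close>, so a quotient by an additive group \<open>H\<close> that contains all
  cocycles has only one element.\<close>

lemma trivial_group_cocycle_quotient:
  assumes sub: "cocycles G \<rho> n \<subseteq> H" and zero: "(\<lambda>xs. 0) \<in> cocycles G \<rho> n"
    and add: "\<And>f h. f \<in> H \<Longrightarrow> h \<in> H \<Longrightarrow> (\<lambda>xs. f xs + h xs) \<in> H"
    and neg: "\<And>f. f \<in> H \<Longrightarrow> (\<lambda>xs. - f xs) \<in> H"
  shows "trivial_group (cocycle_group G \<rho> n Mod H)"
proof -
  have coset: "H #>\<^bsub>cocycle_group G \<rho> n\<^esub> a = H" if "a \<in> H" for a
  proof -
    have "h \<in> (\<lambda>h xs. h xs + a xs) ` H" if "h \<in> H" for h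
      using add[OF that neg[OF \<open>a \<in> H\<close>]] by (intro image_eqI[of _ _ "\<lambda>xs. h xs + - a xs"]) auto
    then show ?thesis
      using add that by (auto simp: r_coset_def cocycle_group_def)
  qed
  have mult: "H <#>\<^bsub>cocycle_group G \<rho> n\<^esub> H = H"
  proof -
    have "H <#>\<^bsub>cocycle_group G \<rho> n\<^esub> H = (\<Union>a\<in>H. H #>\<^bsub>cocycle_group G \<rho> n\<^esub> a)"
      by (auto simp: set_mult_def r_coset_def)
    then show ?thesis
      using coset zero sub by auto
  qed
  have "rcosets\<^bsub>cocycle_group G \<rho> n\<^esub> H = (\<Union>a\<in>cocycles G \<rho> n. {H #>\<^bsub>cocycle_group G \<rho> n\<^esub> a})"
    by (simp add: RCOSETS_def cocycle_group_def)
  also have "\<dots> = (\<Union>a\<in>cocycles G \<rho> n. {H})"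
    using coset sub by (intro SUP_cong refl) auto
  also have "\<dots> = {H}"
    using zero by auto
  finally have carr: "carrier (cocycle_group G \<rho> n Mod H) = {H}"
    by (simp add: FactGroup_def)
  have "group (cocycle_group G \<rho> n Mod H)"
    by (rule groupI) (use mult carr in \<open>auto simp: FactGroup_def\<close>)
  then show ?thesis
    using carr by (simp add: trivial_group_def FactGroup_def)
qed

lemma invariant_cochains_linear:
  assumes \<rho>: "normed_module G \<rho>"
    and f: "f \<in> invariant_cochains G \<rho> n" and h: "h \<in> invariant_cochains G \<rho> n"
  shows "(\<lambda>xs. f xs + c *\<^sub>R h xs) \<in> invariant_cochains G \<rho> n"
proof -
  have "(\<lambda>xs. f xs + c *\<^sub>R h xs) \<in> bounded_cochains G n"
    using f h unfolding invariant_cochains_def bounded_cochains_def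
    by (simp add: bounded_plus_comp bounded_scaleR_comp)
  moreover have "cochain_action G \<rho> n g (\<lambda>xs. f xs + c *\<^sub>R h xs) = (\<lambda>xs. f xs + c *\<^sub>R h xs)"
    if g: "g \<in> carrier G" for g
  proof
    fix xs
    have "linear (\<rho> g)"
      using \<rho> g by (simp add: normed_module_def)
    then have "cochain_action G \<rho> n g (\<lambda>xs. f xs + c *\<^sub>R h xs) xs =
        cochain_action G \<rho> n g f xs + c *\<^sub>R cochain_action G \<rho> n g h xs"
      by (simp add: cochain_action_def linear_add linear_scale)
    then show "cochain_action G \<rho> n g (\<lambda>xs. f xs + c *\<^sub>R h xs) xs = f xs + c *\<^sub>R h xs"
      using f h g by (simp add: invariant_cochains_def)
  qed
  ultimately show ?thesis
    by (simp add: invariant_cochains_def)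
qed

lemma zero_invariant_cochain:
  assumes "normed_module G \<rho>"
  shows "(\<lambda>xs. 0) \<in> invariant_cochains G \<rho> n"
  using assms unfolding invariant_cochains_def bounded_cochains_def normed_module_def
  by (auto simp: cochain_action_def bounded_image_iff linear_0 fun_eq_iff)

lemma differential_linear:
  "differential G n (\<lambda>xs. f xs + c *\<^sub>R h xs) =
     (\<lambda>xs. differential G n f xs + c *\<^sub>R differential G n h xs)"
  by (auto simp: differential_def fun_eq_iff scaleR_add_right scaleR_diff_right
      sum.distrib scaleR_sum_right mult.commute)

lemma coboundaries_linear:
  assumes "normed_module G \<rho>"
    and "f \<in> coboundaries G \<rho> (Suc k)" "h \<in> coboundaries G \<rho> (Suc k)"
  shows "(\<lambda>xs. f xs + c *\<^sub>R h xs) \<in> coboundaries G \<rho> (Suc k)"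
  using assms(2,3) invariant_cochains_linear[OF assms(1)]
  by (auto simp: differential_linear[symmetric])

theorem theorem3p6:
  fixes G :: "('g, 'x) monoid_scheme"
    and \<rho> :: "'g \<Rightarrow> 'v::real_normed_vector \<Rightarrow> 'v"
    and n :: nat
  assumes "group G"
    and "amenable G"
    and "dual_normed_module TYPE('w::real_normed_vector) G \<rho>"
    and "n \<ge> 1"
  shows "trivial_group (bounded_cohomology G \<rho> n)"
proof -
  obtain m where m: "invariant_mean G m"
    using assms(2) by (auto simp: amenable_def)
  obtain \<sigma> :: "'g \<Rightarrow> 'w \<Rightarrow> 'w" where \<rho>: "normed_module G \<rho>"
    and \<sigma>: "normed_module G \<sigma>" and iso: "normed_module_iso G \<rho> (dual_action G \<sigma>)"
    using assms(3) by (auto simp: dual_normed_module_def)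
  obtain M where "module_mean G \<rho> M"
    using module_mean_transport[OF module_mean_dual[OF assms(1) m \<sigma>] iso] by blast
  then interpret module_mean G \<rho> M .
  obtain k where n: "n = Suc k"
    using assms(4) by (cases n) auto
  have zero: "(\<lambda>xs. 0) \<in> cocycles G \<rho> n"
    using zero_invariant_cochain[OF \<rho>] by (auto simp: cocycles_def differential_def)
  have sub: "cocycles G \<rho> n \<subseteq> coboundaries G \<rho> n"
    unfolding n by (rule cocycles_subset_coboundaries)
  note lin = coboundaries_linear[OF \<rho>, of _ k, folded n]
  show ?thesis
    unfolding bounded_cohomology_def
  proof (rule trivial_group_cocycle_quotient[OF sub zero])
    show "(\<lambda>xs. f xs + h xs) \<in> coboundaries G \<rho> n"
      if "f \<in> coboundaries G \<rho> n" "h \<in> coboundaries G \<rho> n" for f h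
      using lin[OF that, of 1] by simp
    show "(\<lambda>xs. - f xs) \<in> coboundaries G \<rho> n" if "f \<in> coboundaries G \<rho> n" for f
      using lin[OF _ that, of "\<lambda>xs. 0" "- 1"] zero sub by auto
  qed
qed

end
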